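(* Let $P(\lambda)$ be a strictly regular $n\times n$ matrix polynomial of degree $d$ over a field $\mathbb{F}$, with Smith form $S(\lambda)=\mathrm{diag}(s_1(\lambda),\dots,s_n(\lambda))$, and assume that all irreducible divisors of $P(\lambda)$ have degree $k$ or less. Organize all of the $\mathbb{F}$-irreducible factors (counted with multiplicity) of $s_1,\dots,s_n$ of degrees $2$ through $k$ into $n$ polynomials $q_1(\lambda),\dots,q_n(\lambda)$ by the stacking procedure described in the context, and define the degree gaps $g_i:=d-\deg q_i$ (some of which may be negative). If the vector in $\mathbb{N}^n$ whose $i$th entry is the number of degree-$1$ irreducible factors (with multiplicity) of $s_i(\lambda)$ majorizes the gap vector $\mathbf{g}:=(g_1,\dots,g_n)$, then $P(\lambda)$ has a triangularization of degree $d$.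
   Context: A matrix polynomial over $\mathbb{F}$ is a matrix with entries in $\mathbb{F}[\lambda]$. An $n\times n$ matrix polynomial of degree $d$ (grade taken equal to degree) is strictly regular if its coefficient of $\lambda^d$ is nonsingular. Two matrix polynomials are unimodularly equivalent if one is obtained from the other by left and right multiplication by unimodular matrix polynomials (square, nonzero constant determinant). The Smith form $\mathrm{diag}(s_1,\dots,s_n)$, with $s_i$ monic and $s_i\mid s_{i+1}$, is the canonical form under unimodular equivalence. An irreducible divisor of $P$ is a non-constant irreducible polynomial in $\mathbb{F}[\lambda]$ dividing some $s_i$. A triangularization of $P$ of degree $d$ is an upper triangular matrix polynomial of degree $d$ over $\mathbb{F}$ unimodularly equivalent to $P$. Stacking procedure: take the multiset of polynomials to be organized, append copies of the constant $1$ until the number of elements is a multiple of $n$, list the elements $a_1,a_2,\dots,a_{(q+1)n}$ in order of non-increasing degree, and set $q_i:=a_i\,a_{n+i}\,a_{2n+i}\cdots a_{qn+i}$ for $i=1,\dots,n$. (Only degrees matter for $\mathbf{g}$.) Majorization: for $\mathbf{x},\mathbf{y}\in\mathbb{Z}^n$ with non-increasing rearrangements $\mathbf{x}',\mathbf{y}'$, $\mathbf{x}$ majorizes $\mathbf{y}$ if $\sum_{i=1}^{\ell}x_i'\ge\sum_{i=1}^{\ell}y_i'$ for $\ell=1,\dots,n$, with equality for $\ell=n$. *)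

theory Defs
  imports
    Jordan_Normal_Form.Determinant
    "HOL-Computational_Algebra.Polynomial_Factorial"
begin

definition matpoly_degree :: "'a::zero poly mat \<Rightarrow> nat" where
  "matpoly_degree P = Max (degree ` elements_mat P)"

definition matpoly_coeff :: "'a::zero poly mat \<Rightarrow> nat \<Rightarrow> 'a mat" where
  "matpoly_coeff P m = map_mat (\<lambda>p. coeff p m) P"

definition strictly_regular :: "'a::field poly mat \<Rightarrow> bool" where
  "strictly_regular P \<longleftrightarrow> square_mat P \<and> det (matpoly_coeff P (matpoly_degree P)) \<noteq> 0"

definition unimodular :: "'a::field poly mat \<Rightarrow> bool" where
  "unimodular U \<longleftrightarrow> square_mat U \<and> (\<exists>c. c \<noteq> 0 \<and> det U = [:c:])"

definition unimodularly_equivalent :: "'a::field poly mat \<Rightarrow> 'a poly mat \<Rightarrow> bool" where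
  "unimodularly_equivalent P Q \<longleftrightarrow>
     (\<exists>U V. unimodular U \<and> unimodular V \<and>
            dim_col U = dim_row P \<and> dim_row V = dim_col P \<and> Q = U * P * V)"

text \<open>
  Only \<open>n \<times> n\<close> matrices with nonzero determinant have a Smith form in this sense, since the
  invariant polynomials are required to be monic. They are indexed \<open>s 0, \<dots>, s (n - 1)\<close>; the
  values of \<open>s\<close> at larger indices are irrelevant.
\<close>
definition is_smith_form :: "nat \<Rightarrow> (nat \<Rightarrow> 'a::field poly) \<Rightarrow> 'a poly mat \<Rightarrow> bool" where
  "is_smith_form n s P \<longleftrightarrow>
     (\<forall>i<n. lead_coeff (s i) = 1) \<and> (\<forall>i. Suc i < n \<longrightarrow> s i dvd s (Suc i)) \<and>
     unimodularly_equivalent P (mat_diag n s)"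

definition irreducible_divisors :: "'a::field poly mat \<Rightarrow> 'a poly set" where
  "irreducible_divisors P =
     {f. irreducible f \<and> (\<exists>n s. is_smith_form n s P \<and> (\<exists>i<n. f dvd s i))}"

definition triangularization :: "'a::field poly mat \<Rightarrow> 'a poly mat \<Rightarrow> bool" where
  "triangularization P T \<longleftrightarrow> upper_triangular T \<and> unimodularly_equivalent P T"

text \<open>
  The irreducible factors with multiplicity, each normalized to be monic. The library's
  \<open>prime_factorization\<close> and \<open>multiplicity\<close> are not available for polynomials over a general
  \<open>field\<close>. For \<open>p \<noteq> 0\<close> the multiset exists and is unique, see below.
\<close>
definition irreducible_factors :: "'a::field poly \<Rightarrow> 'a poly multiset" where
  "irreducible_factors p =
     (THE A. (\<forall>f\<in>#A. lead_coeff f = 1 \<and> irreducible f) \<and> smult (lead_coeff p) (prod_mset A) = p)"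

lemma monic_irreducible_dvd_eq:
  fixes f g :: "'a::field poly"
  assumes "lead_coeff f = 1" "irreducible f" "lead_coeff g = 1" "irreducible g" "f dvd g"
  shows "f = g"
proof -
  obtain u where u: "g = f * u" using assms(5) by (elim dvdE)
  then have "is_unit u" using irreducibleD[OF assms(4)] irreducible_not_unit[OF assms(2)] by blast
  then obtain c where c: "u = [:c:]" by (auto elim!: is_unit_polyE)
  then have "c = 1" using assms(1,3) u by (simp split: if_splits)
  then show ?thesis using c u by simp
qed

lemma monic_irreducible_multiset_unique:
  fixes A B :: "'a::field poly multiset"
  assumes "\<forall>f\<in>#A. lead_coeff f = 1 \<and> irreducible f" "\<forall>f\<in>#B. lead_coeff f = 1 \<and> irreducible f"
    and "prod_mset A = prod_mset B"
  shows "A = B"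
  using assms
proof (induction A arbitrary: B)
  case empty
  have "B = {#}"
  proof (rule ccontr)
    assume "B \<noteq> {#}"
    then obtain f where "f \<in># B" by blast
    moreover from this have "f dvd 1" using dvd_prod_mset empty.prems(3) by fastforce
    ultimately show False using empty.prems(2) irreducible_not_unit by blast
  qed
  then show ?case by simp
next
  case (add x A)
  have x: "lead_coeff x = 1" "irreducible x" using add.prems(1) by auto
  have "prime_elem x" using x(2) by (rule field_poly_irreducible_imp_prime)
  moreover have "x dvd prod_mset B" using add.prems(3) by (metis dvd_triv_left prod_mset.add_mset)
  ultimately obtain y where "y \<in># B" "x dvd y" by (rule prime_elem_dvd_prod_msetE)
  then have "x \<in># B" using add.prems(2) x monic_irreducible_dvd_eq by metis
  then obtain B' where B: "B = add_mset x B'" by (metis mset_add)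
  have "x \<noteq> 0" using x(2) by auto
  then have "A = B'" using add.IH[of B'] add.prems B by simp
  then show ?case using B by simp
qed

lemma ex1_irreducible_factors:
  fixes p :: "'a::field poly"
  assumes "p \<noteq> 0"
  shows "\<exists>!A. (\<forall>f\<in>#A. lead_coeff f = 1 \<and> irreducible f) \<and> smult (lead_coeff p) (prod_mset A) = p"
proof (rule ex_ex1I)
  obtain A where A: "\<And>f. f \<in># A \<Longrightarrow> prime_elem f"
    and prod: "prod_mset A = smult (inverse (lead_coeff p)) p"
    using field_poly_prod_mset_prime_factorization[OF assms]
      field_poly_in_prime_factorization_imp_prime by blast
  define N where "N = (\<lambda>g :: 'a poly. smult (inverse (lead_coeff g)) g)"
  have "lead_coeff (N g) = 1 \<and> irreducible (N g)" if "g \<in># A" for g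
  proof -
    have "irreducible g" using A[OF that] by (rule prime_elem_imp_irreducible)
    moreover have "g \<noteq> 0" using calculation by auto
    moreover have "is_unit [:inverse (lead_coeff g):]" using \<open>g \<noteq> 0\<close> by (simp add: is_unit_pCons_iff)
    then have "irreducible ([:inverse (lead_coeff g):] * g) = irreducible g"
      by (rule irreducible_mult_unit_left)
    ultimately show ?thesis by (simp add: N_def)
  qed
  moreover have "prod_mset (image_mset N B) = N (prod_mset B)" for B
    by (induction B) (simp_all add: N_def lead_coeff_mult mult.commute)
  then have "prod_mset (image_mset N A) = smult (inverse (lead_coeff p)) p"
    using assms by (simp add: prod N_def)
  ultimately show "\<exists>A. (\<forall>f\<in>#A. lead_coeff f = 1 \<and> irreducible f) \<and>
      smult (lead_coeff p) (prod_mset A) = p"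
    using assms by (intro exI[of _ "image_mset N A"]) auto
next
  fix A B :: "'a poly multiset"
  assume A: "(\<forall>f\<in>#A. lead_coeff f = 1 \<and> irreducible f) \<and> smult (lead_coeff p) (prod_mset A) = p"
    and B: "(\<forall>f\<in>#B. lead_coeff f = 1 \<and> irreducible f) \<and> smult (lead_coeff p) (prod_mset B) = p"
  then have "smult (lead_coeff p) (prod_mset A - prod_mset B) = 0"
    by (simp add: smult_diff_right)
  then have "prod_mset A = prod_mset B" using assms by simp
  then show "A = B" using A B monic_irreducible_multiset_unique by blast
qed

text \<open>
  Ties in degree may be broken in any way, so this is a relation between \<open>M\<close> and the list of
  stacked products. With indices starting from 0, entry \<open>i\<close> of \<open>qs\<close> is the product of the
  \<open>a ! (j * n + i)\<close>. If \<open>M\<close> is empty, then no padding occurs and all entries are empty products.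
\<close>
definition stacking :: "nat \<Rightarrow> 'a::field poly multiset \<Rightarrow> 'a poly list \<Rightarrow> bool" where
  "stacking n M qs \<longleftrightarrow>
     (\<exists>a. mset a = M + replicate_mset (LEAST r. n dvd size M + r) 1 \<and>
          sorted_wrt (\<ge>) (map degree a) \<and>
          qs = map (\<lambda>i. \<Prod>j<length a div n. a ! (j * n + i)) [0..<n])"

definition majorizes :: "int list \<Rightarrow> int list \<Rightarrow> bool" where
  "majorizes x y \<longleftrightarrow> length x = length y \<and>
     (\<forall>l\<in>{1..length x}. sum_list (take l (rev (sort x))) \<ge> sum_list (take l (rev (sort y)))) \<and>
     sum_list x = sum_list y"

end

theory Submission
  imports Defs
begin

text \<open>
  The Smith form is equivalent to \<open>P\<close> and triangular, but the degrees on its diagonal are in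
  general different from \<open>d\<close>. It suffices to change the diagonal until all of its
  entries have degree \<open>d\<close>; then the entries above the diagonal can be reduced modulo the diagonal
  ones without leaving the degree bound (\<open>reduced_triangularization\<close>).

  The tool for changing the diagonal is \<open>diagonal_exchange\<close>: in a triangular matrix with
  nonzero diagonal entries, two of these, \<open>a\<close> and \<open>b\<close>, may be replaced by \<open>a'\<close> and \<open>b'\<close>
  whenever \<open>a' * b' = a * b\<close> and every common divisor of \<open>a\<close> and \<open>b\<close> divides both \<open>a'\<close> and \<open>b'\<close>. For adjacent entries this is a computation
  with the Smith form of a \<open>2 \<times> 2\<close> block, and interchanging neighbours is a special case.
  In terms of irreducible factors, an irreducible \<open>p\<close> may be moved from one diagonal entry to
  another one in which it has smaller multiplicity (\<open>common_divisor_transfer\<close>). The rest is a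
  combinatorial question: which distributions of the factors can be reached from that of the Smith
  form by such moves?

  Factors of degree 1 are moved first. Because of \<open>s i dvd s (Suc i)\<close> their numbers are
  non-decreasing in \<open>i\<close>, and so are the gaps, because the degrees of stacked products are
  non-increasing. Hence majorization says that the prefix sums of the numbers are at most those of
  the gaps, and Muirhead's argument yields moves after which the \<open>i\<close>-th entry has as many linear
  factors as the \<open>i\<close>-th gap requires (\<open>majorization_transfers\<close>). In particular no gap is
  negative. Each move goes from an entry with more linear factors to one with fewer, so some
  irreducible factor is available for it.

  The factors of larger degree are then moved to the columns of the stacking. Once equal
  factors of the stacking are made neighbours, which is possible without changing the degrees,
  each irreducible polynomial is spread over the columns as evenly as possible
  (\<open>stacking_columns\<close>), and an even distribution can be reached from any other one
  (\<open>balancing_transfers\<close>). Now the \<open>i\<close>-th diagonal entry has degree \<open>degree (q ! i)\<close> plus the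
  \<open>i\<close>-th gap, which is \<open>d\<close>.
\<close>

section \<open>Row and column operations on two indices\<close>

text \<open>
  The identity matrix with its rows and columns \<open>i\<close> and \<open>j\<close> replaced by the
  \<open>2 \<times> 2\<close> block with rows \<open>(p, q)\<close> and \<open>(r, s)\<close>. For determinant 1 this one family supplies
  all elementary operations that are used below: adding a multiple of one line to another, and
  swapping two lines up to sign.
\<close>
definition embed2 ::
  "nat \<Rightarrow> nat \<Rightarrow> nat \<Rightarrow> 'b::comm_ring_1 \<Rightarrow> 'b \<Rightarrow> 'b \<Rightarrow> 'b \<Rightarrow> 'b mat" where
  "embed2 n i j p q r s = mat n n (\<lambda>(u, v).
     if u = i then (if v = i then p else if v = j then q else 0)
     else if u = j then (if v = i then r else if v = j then s else 0)
     else if u = v then 1 else 0)"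

lemma embed2_carrier [simp]: "embed2 n i j p q r s \<in> carrier_mat n n"
  by (simp add: embed2_def)

lemma sum_two_indices:
  fixes f :: "nat \<Rightarrow> 'b::comm_ring_1"
  assumes "i \<noteq> j" "i < n" "j < n"
  shows "(\<Sum>k = 0..<n. (if k = i then p else if k = j then q else 0) * f k) = p * f i + q * f j"
proof -
  have "(if k = i then p else if k = j then q else 0) * f k =
      (if k = i then p * f k else 0) + (if k = j then q * f k else 0)" for k
    using assms(1) by auto
  then show ?thesis using assms by (simp add: sum.distrib)
qed

lemma index_embed2_mult:
  assumes "i \<noteq> j" "i < n" "j < n" "X \<in> carrier_mat n n" "u < n" "v < n"
  shows "(embed2 n i j p q r s * X) $$ (u, v) =
    (if u = i then p * X $$ (i, v) + q * X $$ (j, v)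
     else if u = j then r * X $$ (i, v) + s * X $$ (j, v) else X $$ (u, v))"
proof -
  have "(embed2 n i j p q r s * X) $$ (u, v) =
      (\<Sum>k = 0..<n. embed2 n i j p q r s $$ (u, k) * X $$ (k, v))"
    using assms(4-6) by (simp add: scalar_prod_def embed2_def)
  also have "\<dots> = (\<Sum>k = 0..<n.
      (if u = i then (if k = i then p else if k = j then q else 0)
       else if u = j then (if k = i then r else if k = j then s else 0)
       else if k = u then 1 else 0) * X $$ (k, v))"
    using assms(5) by (intro sum.cong) (auto simp: embed2_def)
  finally show ?thesis
    using assms sum_two_indices[OF assms(1-3), of _ _ "\<lambda>k. X $$ (k, v)"]
    by (auto simp: if_distrib[of "\<lambda>x. x * _"] cong: if_cong)
qed

lemma transpose_embed2: "transpose_mat (embed2 n i j p q r s) = embed2 n i j p r q s"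
  by (rule eq_matI) (auto simp: embed2_def)

lemma index_mult_embed2:
  assumes "i \<noteq> j" "i < n" "j < n" "X \<in> carrier_mat n n" "u < n" "v < n"
  shows "(X * embed2 n i j p q r s) $$ (u, v) =
    (if v = i then p * X $$ (u, i) + r * X $$ (u, j)
     else if v = j then q * X $$ (u, i) + s * X $$ (u, j) else X $$ (u, v))"
proof -
  have "(X * embed2 n i j p q r s) $$ (u, v) =
      transpose_mat (X * embed2 n i j p q r s) $$ (v, u)"
    using assms(4-6) by (simp add: embed2_def)
  also have "transpose_mat (X * embed2 n i j p q r s) =
      embed2 n i j p r q s * transpose_mat X"
    using transpose_mult[OF assms(4) embed2_carrier] by (simp add: transpose_embed2)
  finally show ?thesis using assms by (simp add: index_embed2_mult)
qed

text \<open>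
  The inverse is the embedding of the adjugate block, so the determinant divides 1 and is a
  nonzero constant; the determinant itself need not be computed.
\<close>
lemma unimodular_embed2:
  fixes p q r s :: "'a::field poly"
  assumes "i \<noteq> j" "i < n" "j < n" "p * s - q * r = 1"
  shows "unimodular (embed2 n i j p q r s)"
proof -
  have "embed2 n i j p q r s * embed2 n i j s (- q) (- r) p = 1\<^sub>m n"
  proof (rule eq_matI)
    fix u v assume "u < dim_row (1\<^sub>m n :: 'a poly mat)" "v < dim_col (1\<^sub>m n :: 'a poly mat)"
    then show "(embed2 n i j p q r s * embed2 n i j s (- q) (- r) p) $$ (u, v) =
        (1\<^sub>m n :: 'a poly mat) $$ (u, v)"
      using assms by (auto simp: index_embed2_mult) (auto simp: embed2_def algebra_simps)
  qed (simp_all add: embed2_def)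
  then have "det (embed2 n i j p q r s) * det (embed2 n i j s (- q) (- r) p) = 1"
    by (metis det_mult det_one embed2_carrier)
  then have "is_unit (det (embed2 n i j p q r s))" by (metis dvd_triv_left)
  then show ?thesis unfolding unimodular_def by (auto elim!: is_unit_polyE simp: embed2_def)
qed

lemma unimodular_mult:
  assumes "unimodular U" "unimodular W" "U \<in> carrier_mat m m" "W \<in> carrier_mat m m"
  shows "unimodular (U * W)"
proof -
  obtain c c' where "c \<noteq> 0" "det U = [:c:]" "c' \<noteq> 0" "det W = [:c':]"
    using assms(1,2) unfolding unimodular_def by blast
  then have "det (U * W) = [:c * c':]" "c * c' \<noteq> 0"
    using det_mult[OF assms(3,4)] by simp_all
  then show ?thesis using assms(3,4) unfolding unimodular_def by auto
qed

lemma unimodularly_equivalent_mult_left: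
  assumes eq: "unimodularly_equivalent P T" and W: "unimodular W" "dim_col W = dim_row T"
  shows "unimodularly_equivalent P (W * T)"
proof -
  obtain U V where U: "unimodular U" "dim_col U = dim_row P"
    and V: "unimodular V" "dim_row V = dim_col P" and T: "T = U * P * V"
    using eq unfolding unimodularly_equivalent_def by blast
  have cU: "U \<in> carrier_mat (dim_row P) (dim_row P)"
    using U unfolding unimodular_def by (intro carrier_matI) simp_all
  have cV: "V \<in> carrier_mat (dim_col P) (dim_col P)"
    using V unfolding unimodular_def by (intro carrier_matI) simp_all
  have cW: "W \<in> carrier_mat (dim_row P) (dim_row P)"
    using W T cU unfolding unimodular_def by (intro carrier_matI) simp_all
  have cP: "P \<in> carrier_mat (dim_row P) (dim_col P)" by (intro carrier_matI) simp_all
  have "W * T = W * (U * P) * V"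
    unfolding T by (rule assoc_mult_mat[OF cW mult_carrier_mat[OF cU cP] cV, symmetric])
  also have "W * (U * P) = (W * U) * P" by (rule assoc_mult_mat[OF cW cU cP, symmetric])
  finally have "W * T = (W * U) * P * V" .
  moreover have "unimodular (W * U)" by (rule unimodular_mult[OF W(1) U(1) cW cU])
  ultimately show ?thesis unfolding unimodularly_equivalent_def using U(2) V
    by (intro exI[of _ "W * U"] exI[of _ V]) simp
qed

lemma unimodularly_equivalent_mult_right:
  assumes eq: "unimodularly_equivalent P T" and W: "unimodular W" "dim_row W = dim_col T"
  shows "unimodularly_equivalent P (T * W)"
proof -
  obtain U V where U: "unimodular U" "dim_col U = dim_row P"
    and V: "unimodular V" "dim_row V = dim_col P" and T: "T = U * P * V"
    using eq unfolding unimodularly_equivalent_def by blast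
  have cU: "U \<in> carrier_mat (dim_row P) (dim_row P)"
    using U unfolding unimodular_def by (intro carrier_matI) simp_all
  have cV: "V \<in> carrier_mat (dim_col P) (dim_col P)"
    using V unfolding unimodular_def by (intro carrier_matI) simp_all
  have cW: "W \<in> carrier_mat (dim_col P) (dim_col P)"
    using W T cV unfolding unimodular_def by (intro carrier_matI) simp_all
  have cP: "P \<in> carrier_mat (dim_row P) (dim_col P)" by (intro carrier_matI) simp_all
  have "T * W = U * P * (V * W)"
    unfolding T by (rule assoc_mult_mat[OF mult_carrier_mat[OF cU cP] cV cW])
  moreover have "unimodular (V * W)" by (rule unimodular_mult[OF V(1) W(1) cV cW])
  ultimately show ?thesis unfolding unimodularly_equivalent_def using U V(2)
    by (intro exI[of _ U] exI[of _ "V * W"]) simp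
qed

section \<open>Exchanging diagonal entries\<close>

text \<open>
  The \<open>2 \<times> 2\<close> case, for the set \<open>R\<close> of blocks
  \<open>(w, x; y, z)\<close> that can be reached by row and column operations of determinant 1. As \<open>R\<close> is
  abstract, the lemma applies to a diagonal block of a larger matrix without any embedding.

  A reachable block whose upper left entry is nonzero of minimal degree can be cleared to
  \<open>diag(w, z)\<close> with \<open>w dvd z\<close>, as in the computation of the Smith form. Common divisors of the
  entries are invariant under the operations, so \<open>w\<close> divides \<open>a\<close> and \<open>b\<close>, and hence \<open>a'\<close> and
  \<open>b'\<close>. As \<open>w * z = a' * b'\<close>, the block with rows \<open>(a', w)\<close> and \<open>(0, b')\<close> has the same Smith
  form, and three more operations lead to it.
\<close>
lemma two_by_two_exchange:
  fixes R :: "'a::field poly \<Rightarrow> 'a poly \<Rightarrow> 'a poly \<Rightarrow> 'a poly \<Rightarrow> bool"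
  assumes rows: "\<And>w x y z p q r s. R w x y z \<Longrightarrow> p * s - q * r = 1 \<Longrightarrow>
      R (p * w + q * y) (p * x + q * z) (r * w + s * y) (r * x + s * z)"
    and cols: "\<And>w x y z p q r s. R w x y z \<Longrightarrow> p * s - q * r = 1 \<Longrightarrow>
      R (p * w + r * x) (q * w + s * x) (p * y + r * z) (q * y + s * z)"
    and start: "R a x0 0 b" and nz: "a \<noteq> 0"
    and prod: "a' * b' = a * b"
    and div: "\<And>c. c dvd a \<Longrightarrow> c dvd b \<Longrightarrow> c dvd a' \<and> c dvd b'"
  shows "\<exists>x. R a' x 0 b'"
proof -
  define S where "S w x y z \<longleftrightarrow> R w x y z \<and> w * z - x * y = a * b \<and>
    (\<forall>c. c dvd w \<longrightarrow> c dvd x \<longrightarrow> c dvd y \<longrightarrow> c dvd z \<longrightarrow> c dvd a \<and> c dvd b)" for w x y z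
  \<comment> \<open>A block of determinant 1 is invertible, so an operation creates no new common divisors.\<close>
  have recover: "c dvd u \<and> c dvd v"
    if "c dvd p * u + q * v" "c dvd r * u + s * v" "p * s - q * r = 1" for c u v p q r s :: "'a poly"
  proof -
    have "u = (p * s - q * r) * u" "v = (p * s - q * r) * v" using that(3) by simp_all
    then have "u = s * (p * u + q * v) - q * (r * u + s * v)"
      "v = p * (r * u + s * v) - r * (p * u + q * v)"
      by (simp_all add: algebra_simps)
    then show ?thesis using that(1,2) by (metis dvd_diff dvd_mult)
  qed
  have S_rows: "S (p * w + q * y) (p * x + q * z) (r * w + s * y) (r * x + s * z)"
    if "S w x y z" and pq: "p * s - q * r = 1" for w x y z p q r s
  proof -
    have "(p * w + q * y) * (r * x + s * z) - (p * x + q * z) * (r * w + s * y) =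
        (p * s - q * r) * (w * z - x * y)"
      by (simp add: algebra_simps)
    then have det: "(p * w + q * y) * (r * x + s * z) - (p * x + q * z) * (r * w + s * y) = a * b"
      using that unfolding S_def by simp
    have "c dvd a \<and> c dvd b" if "c dvd p * w + q * y" "c dvd p * x + q * z"
      "c dvd r * w + s * y" "c dvd r * x + s * z" for c
      using \<open>S w x y z\<close> recover[OF that(1,3) pq] recover[OF that(2,4) pq] unfolding S_def by blast
    moreover have "R w x y z" using \<open>S w x y z\<close> unfolding S_def by blast
    ultimately show ?thesis using det rows[OF _ pq] unfolding S_def by metis
  qed
  have S_cols: "S (p * w + r * x) (q * w + s * x) (p * y + r * z) (q * y + s * z)"
    if "S w x y z" and pq: "p * s - q * r = 1" for w x y z p q r s
  proof -
    have "(p * w + r * x) * (q * y + s * z) - (q * w + s * x) * (p * y + r * z) =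
        (p * s - q * r) * (w * z - x * y)"
      by (simp add: algebra_simps)
    then have det: "(p * w + r * x) * (q * y + s * z) - (q * w + s * x) * (p * y + r * z) = a * b"
      using that unfolding S_def by simp
    have pq': "p * s - r * q = 1" using pq by (simp add: mult.commute)
    have "c dvd a \<and> c dvd b" if "c dvd p * w + r * x" "c dvd q * w + s * x"
      "c dvd p * y + r * z" "c dvd q * y + s * z" for c
      using \<open>S w x y z\<close> recover[OF that(1,2) pq'] recover[OF that(3,4) pq'] unfolding S_def by blast
    moreover have "R w x y z" using \<open>S w x y z\<close> unfolding S_def by blast
    ultimately show ?thesis using det cols[OF _ pq] unfolding S_def by metis
  qed
  define D where "D m \<longleftrightarrow> (\<exists>w x y z. S w x y z \<and> w \<noteq> 0 \<and> degree w = m)" for m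
  have "S a x0 0 b" using start unfolding S_def by simp
  then have "D (degree a)" using nz unfolding D_def by blast
  then have "D (LEAST m. D m)" by (rule LeastI)
  then obtain w x y z where wxyz: "S w x y z" and w: "w \<noteq> 0" "degree w = (LEAST m. D m)"
    unfolding D_def by blast
  have minimal: "w' = 0 \<or> degree w \<le> degree w'" if "S w' x' y' z'" for w' x' y' z'
    using that w(2) Least_le[of D "degree w'"] unfolding D_def by auto
  have small: "u = 0" if "u = v mod w" "u = 0 \<or> degree w \<le> degree u" for u v
    using that degree_mod_less[OF w(1), of v] by auto
  have row_div: "w dvd x'" if "S w x' y' z'" for x' y' z'
  proof -
    have "S w (x' mod w) y' (z' - x' div w * y')"
      using S_cols[OF that, of 1 1 "- (x' div w)" 0]
      by (simp add: minus_div_mult_eq_mod[symmetric])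
    from S_cols[OF this, of 0 0 "-1" 1] have "x' mod w = 0" using minimal small by simp
    then show ?thesis by (simp add: dvd_eq_mod_eq_0)
  qed
  have col_div: "w dvd y'" if "S w x' y' z'" for x' y' z'
  proof -
    have "S w x' (y' mod w) (z' - y' div w * x')"
      using S_rows[OF that, of 1 1 0 "- (y' div w)"]
      by (simp add: minus_div_mult_eq_mod[symmetric])
    from S_rows[OF this, of 0 0 1 "-1"] have "y' mod w = 0" using minimal small by simp
    then show ?thesis by (simp add: dvd_eq_mod_eq_0)
  qed
  obtain e where "x = w * e" using row_div[OF wxyz] by blast
  then have "S w 0 y (z - e * y)" using S_cols[OF wxyz, of 1 1 "- e" 0] by simp
  moreover obtain f where "y = w * f" using col_div[OF wxyz] by blast
  ultimately obtain z' where diag: "S w 0 0 z'"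
    using S_rows[of w 0 y "z - e * y" 1 1 0 "- f"] by auto
  have "w dvd z'" using S_rows[OF diag, of 1 1 1 0] row_div by simp
  then have "w dvd a'" "w dvd b'" using diag div unfolding S_def by auto
  then obtain \<alpha> \<beta> where \<alpha>: "a' = w * \<alpha>" and \<beta>: "b' = w * \<beta>" by (elim dvdE)
  have "w * z' = a' * b'" using diag prod unfolding S_def by simp
  then have z': "z' = w * \<alpha> * \<beta>" using w(1) \<alpha> \<beta> by simp
  \<comment> \<open>Swap the columns up to sign; then \<open>w\<close> serves to fill in both diagonal entries.\<close>
  have "S 0 w (- z') 0" using S_cols[OF diag, of 0 0 1 "-1"] by simp
  from S_rows[OF this, of 1 1 0 \<beta>] have "S 0 w (- z') b'" using \<beta> by (simp add: mult.commute)
  from S_cols[OF this, of 1 1 0 \<alpha>] have "S a' w 0 b'"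
    using \<alpha> \<beta> z' by (simp add: algebra_simps)
  then show ?thesis unfolding S_def by blast
qed

definition has_triangular_diagonal :: "'a::field poly mat \<Rightarrow> nat \<Rightarrow> (nat \<Rightarrow> 'a poly) \<Rightarrow> bool" where
  "has_triangular_diagonal P n t \<longleftrightarrow>
     (\<exists>T \<in> carrier_mat n n. triangularization P T \<and> (\<forall>i<n. T $$ (i, i) = t i))"

text \<open>
  Adjacent positions are what keeps the matrix triangular: operations on the lines \<open>i\<close> and
  \<open>Suc i\<close> affect only one entry below the diagonal, the one at \<open>(Suc i, i)\<close>, which belongs to the
  diagonal block and is zero again at the end.
\<close>
lemma adjacent_exchange:
  assumes t: "has_triangular_diagonal P n t" and i: "Suc i < n" and nz: "t i \<noteq> 0"
    and prod: "a' * b' = t i * t (Suc i)"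
    and div: "\<And>c. c dvd t i \<Longrightarrow> c dvd t (Suc i) \<Longrightarrow> c dvd a' \<and> c dvd b'"
  shows "has_triangular_diagonal P n (t(i := a', Suc i := b'))"
proof -
  define R where "R w x y z \<longleftrightarrow> (\<exists>T \<in> carrier_mat n n. unimodularly_equivalent P T \<and>
      (\<forall>u v. u < n \<longrightarrow> v < u \<longrightarrow> (u, v) \<noteq> (Suc i, i) \<longrightarrow> T $$ (u, v) = 0) \<and>
      (\<forall>u<n. u \<noteq> i \<longrightarrow> u \<noteq> Suc i \<longrightarrow> T $$ (u, u) = t u) \<and>
      T $$ (i, i) = w \<and> T $$ (i, Suc i) = x \<and> T $$ (Suc i, i) = y \<and> T $$ (Suc i, Suc i) = z)"
    for w x y z
  have "R (p * w + q * y) (p * x + q * z) (r * w + s * y) (r * x + s * z)"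
    if R: "R w x y z" and "p * s - q * r = 1" for w x y z p q r s
  proof -
    obtain T where T: "T \<in> carrier_mat n n" "unimodularly_equivalent P T"
      and "\<forall>u v. u < n \<longrightarrow> v < u \<longrightarrow> (u, v) \<noteq> (Suc i, i) \<longrightarrow> T $$ (u, v) = 0"
        "\<forall>u<n. u \<noteq> i \<longrightarrow> u \<noteq> Suc i \<longrightarrow> T $$ (u, u) = t u"
        "T $$ (i, i) = w \<and> T $$ (i, Suc i) = x \<and> T $$ (Suc i, i) = y \<and> T $$ (Suc i, Suc i) = z"
      using R unfolding R_def by blast
    moreover have "unimodularly_equivalent P (embed2 n i (Suc i) p q r s * T)"
      using T i that(2) unimodular_embed2[of i "Suc i" n p s q r]
      by (intro unimodularly_equivalent_mult_left) (auto simp: embed2_def)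
    ultimately show ?thesis
      using i unfolding R_def
      by (intro bexI[of _ "embed2 n i (Suc i) p q r s * T"])
        (auto simp: index_embed2_mult mult_carrier_mat[OF embed2_carrier])
  qed
  moreover have "R (p * w + r * x) (q * w + s * x) (p * y + r * z) (q * y + s * z)"
    if R: "R w x y z" and "p * s - q * r = 1" for w x y z p q r s
  proof -
    obtain T where T: "T \<in> carrier_mat n n" "unimodularly_equivalent P T"
      and "\<forall>u v. u < n \<longrightarrow> v < u \<longrightarrow> (u, v) \<noteq> (Suc i, i) \<longrightarrow> T $$ (u, v) = 0"
        "\<forall>u<n. u \<noteq> i \<longrightarrow> u \<noteq> Suc i \<longrightarrow> T $$ (u, u) = t u"
        "T $$ (i, i) = w \<and> T $$ (i, Suc i) = x \<and> T $$ (Suc i, i) = y \<and> T $$ (Suc i, Suc i) = z"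
      using R unfolding R_def by blast
    moreover have "unimodularly_equivalent P (T * embed2 n i (Suc i) p q r s)"
      using T i that(2) unimodular_embed2[of i "Suc i" n p s q r]
      by (intro unimodularly_equivalent_mult_right) (auto simp: embed2_def)
    ultimately show ?thesis
      using i unfolding R_def
      by (intro bexI[of _ "T * embed2 n i (Suc i) p q r s"])
        (auto simp: index_mult_embed2 mult_carrier_mat[OF _ embed2_carrier])
  qed
  moreover obtain x where "R (t i) x 0 (t (Suc i))"
  proof -
    obtain T where T: "T \<in> carrier_mat n n" "triangularization P T" "\<forall>i<n. T $$ (i, i) = t i"
      using t unfolding has_triangular_diagonal_def by blast
    then have "R (t i) (T $$ (i, Suc i)) 0 (t (Suc i))"
      using i unfolding R_def triangularization_def upper_triangular_def
      by (intro bexI[of _ T]) auto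
    then show thesis by (rule that)
  qed
  ultimately have "\<exists>x'. R a' x' 0 b'"
    using nz prod div by (rule two_by_two_exchange[of R "t i" x "t (Suc i)" a' b'])
  then obtain x' where "R a' x' 0 b'" by blast
  then obtain T where T: "T \<in> carrier_mat n n" "unimodularly_equivalent P T"
      and below: "\<forall>u v. u < n \<longrightarrow> v < u \<longrightarrow> (u, v) \<noteq> (Suc i, i) \<longrightarrow> T $$ (u, v) = 0"
      and diag: "\<forall>u<n. u \<noteq> i \<longrightarrow> u \<noteq> Suc i \<longrightarrow> T $$ (u, u) = t u"
        "T $$ (i, i) = a'" "T $$ (Suc i, i) = 0" "T $$ (Suc i, Suc i) = b'"
    unfolding R_def by blast
  have "upper_triangular T" unfolding upper_triangular_def using T(1) below diag(3)
    by (metis carrier_matD(1) prod.inject)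
  then show ?thesis unfolding has_triangular_diagonal_def triangularization_def
    using T diag by (intro bexI[of _ T]) auto
qed

text \<open>
  Interchanging two adjacent diagonal entries is itself an admissible exchange, since \<open>b\<close> and
  \<open>a\<close> have the same common divisors as \<open>a\<close> and \<open>b\<close>. So distant entries can be made adjacent,
  exchanged, and brought back.
\<close>
lemma diagonal_exchange:
  assumes "has_triangular_diagonal P n t" and "i < n" "j < n" "i \<noteq> j" and "\<And>l. l < n \<Longrightarrow> t l \<noteq> 0"
    and "a' * b' = t i * t j"
    and "\<And>c. c dvd t i \<Longrightarrow> c dvd t j \<Longrightarrow> c dvd a' \<and> c dvd b'"
  shows "has_triangular_diagonal P n (t(i := a', j := b'))"
proof -
  have less: "has_triangular_diagonal P n (t(i := a', i + Suc m := b'))"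
    if "has_triangular_diagonal P n t" and "i + Suc m < n" and "\<And>l. l < n \<Longrightarrow> t l \<noteq> 0"
      and "a' * b' = t i * t (i + Suc m)"
      and "\<And>c. c dvd t i \<Longrightarrow> c dvd t (i + Suc m) \<Longrightarrow> c dvd a' \<and> c dvd b'" for i m t a' b'
    using that
  proof (induction m arbitrary: t)
    case 0
    have "i + Suc 0 = Suc i" by simp
    then show ?case using 0 by (metis adjacent_exchange Suc_lessD)
  next
    case (Suc m)
    let ?k = "i + Suc m"
    \<comment> \<open>Swap the entries at \<open>?k\<close> and \<open>Suc ?k\<close>, exchange at \<open>i\<close> and \<open>?k\<close>, swap back.\<close>
    let ?t = "t(?k := t (Suc ?k), Suc ?k := t ?k)"
    let ?t' = "?t(i := a', ?k := b')"
    have "has_triangular_diagonal P n ?t"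
      using Suc.prems by (intro adjacent_exchange) (auto simp: mult.commute)
    then have "has_triangular_diagonal P n ?t'"
      by (rule Suc.IH) (use Suc.prems in auto)
    moreover have "b' \<noteq> 0"
      using Suc.prems(2,4) Suc.prems(3)[of i] Suc.prems(3)[of "i + Suc (Suc m)"] by auto
    ultimately have "has_triangular_diagonal P n (?t'(?k := ?t' (Suc ?k), Suc ?k := ?t' ?k))"
      using Suc.prems(2) by (intro adjacent_exchange) (auto simp: mult.commute)
    moreover have "?t'(?k := ?t' (Suc ?k), Suc ?k := ?t' ?k) = t(i := a', i + Suc (Suc m) := b')"
      by (rule ext) auto
    ultimately show ?case by (simp only:)
  qed
  show ?thesis
  proof (cases "i < j")
    case True
    then obtain m where m: "j = i + Suc m" using less_iff_Suc_add by auto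
    show ?thesis unfolding m by (rule less) (use assms m in auto)
  next
    case False
    then have "j < i" using assms(4) by simp
    then obtain m where m: "i = j + Suc m" using less_iff_Suc_add by auto
    have "has_triangular_diagonal P n (t(j := b', j + Suc m := a'))"
      by (rule less) (use assms m in \<open>auto simp: mult.commute\<close>)
    then show ?thesis unfolding m using assms(4) m by (subst fun_upd_twist) simp_all
  qed
qed

text \<open>
  Subtracting a multiple of column \<open>i\<close> from column \<open>j\<close> with \<open>i < j\<close> reduces the entry at
  \<open>(i, j)\<close> modulo \<open>t i\<close> and changes only entries above it. Hence the entries can be reduced
  column by column, each column from bottom to top; the number \<open>j * n + (n - 1 - i)\<close> is the
  position of \<open>(i, j)\<close> in this order. The bound is not strict because of constant \<open>t i\<close>, where the
  remainder is 0.
\<close>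
lemma reduced_triangularization:
  assumes "has_triangular_diagonal P n t" and nz: "\<And>i. i < n \<Longrightarrow> t i \<noteq> 0"
  shows "\<exists>T \<in> carrier_mat n n. triangularization P T \<and> (\<forall>i<n. T $$ (i, i) = t i) \<and>
    (\<forall>i j. i < j \<longrightarrow> j < n \<longrightarrow> degree (T $$ (i, j)) \<le> degree (t i))"
proof -
  have "\<exists>T \<in> carrier_mat n n. triangularization P T \<and> (\<forall>i<n. T $$ (i, i) = t i) \<and>
    (\<forall>i j. i < j \<longrightarrow> j < n \<longrightarrow> j * n + (n - 1 - i) < m \<longrightarrow> degree (T $$ (i, j)) \<le> degree (t i))"
    for m
  proof (induction m)
    case 0
    then show ?case using assms(1) unfolding has_triangular_diagonal_def by simp
  next
    case (Suc m)
    then obtain T where T: "T \<in> carrier_mat n n" "triangularization P T" "\<forall>i<n. T $$ (i, i) = t i"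
      and deg: "\<And>i j. i < j \<Longrightarrow> j < n \<Longrightarrow> j * n + (n - 1 - i) < m \<Longrightarrow> degree (T $$ (i, j)) \<le> degree (t i)"
      by blast
    show ?case
    proof (cases "\<exists>i j. i < j \<and> j < n \<and> j * n + (n - 1 - i) = m")
      case False
      then show ?thesis using T deg less_antisym by blast
    next
      case True
      then obtain i j where ij: "i < j" "j < n" "j * n + (n - 1 - i) = m" by blast
      have unique: "j' = j \<and> i' = i" if "i' < j'" "j' < n" "j' * n + (n - 1 - i') = m" for i' j'
      proof -
        have "(u * n + v) div n = u \<and> (u * n + v) mod n = v" if "v < n" for u v
          using that by simp
        moreover have "n - 1 - i' < n" "n - 1 - i < n" using ij(2) by simp_all
        ultimately have "j' = j" "n - 1 - i' = n - 1 - i" using that(3) ij(3) by metis+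
        then show ?thesis using that ij by auto
      qed
      define V where "V = embed2 n i j 1 (- (T $$ (i, j) div t i)) 0 1"
      have V: "V \<in> carrier_mat n n" "unimodular V"
        unfolding V_def using ij by (auto intro!: unimodular_embed2)
      have TV: "(T * V) $$ (u, v) =
          (if v = j then T $$ (u, j) - T $$ (i, j) div t i * T $$ (u, i) else T $$ (u, v))"
        if "u < n" "v < n" for u v
        unfolding V_def using ij T(1) that by (auto simp: index_mult_embed2)
      have zero: "T $$ (u, v) = 0" if "v < u" "u < n" for u v
        using T that unfolding triangularization_def upper_triangular_def by auto
      have "triangularization P (T * V)"
        using T V ij zero unimodularly_equivalent_mult_right[of P T V]
        unfolding triangularization_def upper_triangular_def by (auto simp: TV simp del: index_mult_mat(1))
      moreover have "\<forall>u<n. (T * V) $$ (u, u) = t u"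
        using T(3) ij zero by (auto simp: TV simp del: index_mult_mat(1))
      moreover have "degree ((T * V) $$ (u, v)) \<le> degree (t u)"
        if uv: "u < v" "v < n" "v * n + (n - 1 - u) < Suc m" for u v
      proof (cases "v * n + (n - 1 - u) = m")
        case True
        then have "u = i" "v = j" using unique uv by auto
        then have "(T * V) $$ (u, v) = T $$ (i, j) mod t i"
          using ij T(3) by (simp add: TV minus_div_mult_eq_mod del: index_mult_mat(1))
        then show ?thesis using degree_mod_less[OF nz, of i "T $$ (i, j)"] ij \<open>u = i\<close> by auto
      next
        case False
        then have "v * n + (n - 1 - u) < m" using uv by simp
        then have "v = j \<Longrightarrow> i < u" using ij(3) uv ij by auto
        then have "(T * V) $$ (u, v) = T $$ (u, v)" using uv zero by (auto simp: TV simp del: index_mult_mat(1))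
        then show ?thesis using deg[of u v] False uv by simp
      qed
      ultimately show ?thesis using T(1) V(1) by (intro bexI[of _ "T * V"]) auto
    qed
  qed
  from this[of "n * n"] show ?thesis
  proof
    fix T assume T: "T \<in> carrier_mat n n" "triangularization P T \<and> (\<forall>i<n. T $$ (i, i) = t i) \<and>
      (\<forall>i j. i < j \<longrightarrow> j < n \<longrightarrow> j * n + (n - 1 - i) < n * n \<longrightarrow> degree (T $$ (i, j)) \<le> degree (t i))"
    have "j * n + (n - 1 - i) < n * n" if "j < n" for i j
    proof -
      have "j * n + (n - 1 - i) < Suc j * n" using that by simp
      also have "\<dots> \<le> n * n" using that by (intro mult_le_mono1) simp
      finally show ?thesis .
    qed
    then show ?thesis using T by blast
  qed
qed

lemma triangularization_of_uniform_diagonal_degree: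
  assumes "has_triangular_diagonal P n t" and "0 < n"
    and t: "\<And>i. i < n \<Longrightarrow> t i \<noteq> 0 \<and> degree (t i) = d"
  shows "\<exists>T. triangularization P T \<and> matpoly_degree T = d"
proof -
  obtain T where T: "T \<in> carrier_mat n n" "triangularization P T" "\<forall>i<n. T $$ (i, i) = t i"
    and above: "\<forall>i j. i < j \<longrightarrow> j < n \<longrightarrow> degree (T $$ (i, j)) \<le> degree (t i)"
    using reduced_triangularization[OF assms(1)] t by blast
  have "degree (T $$ (i, j)) \<le> d" if "i < n" "j < n" for i j
  proof (cases i j rule: linorder_cases)
    case greater
    then show ?thesis using T(1,2) that unfolding triangularization_def upper_triangular_def by auto
  qed (use T(3) above t that in auto)
  then have "Max (degree ` elements_mat T) = d"
    using T(1,3) t[of 0] assms(2)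
    by (intro Max_eqI) (auto simp: elements_mat_def image_iff intro!: bexI[of _ 0])
  then show ?thesis using T(2) unfolding matpoly_degree_def by blast
qed

section \<open>Transferring irreducible factors between diagonal entries\<close>

lemma irreducible_factors_spec:
  fixes f :: "'a::field poly"
  assumes "lead_coeff f = 1"
  shows "\<forall>g\<in>#irreducible_factors f. lead_coeff g = 1 \<and> irreducible g"
    and "prod_mset (irreducible_factors f) = f"
proof -
  have "f \<noteq> 0" using assms by auto
  from theI'[OF ex1_irreducible_factors[OF this]] show
    "\<forall>g\<in>#irreducible_factors f. lead_coeff g = 1 \<and> irreducible g"
    "prod_mset (irreducible_factors f) = f"
    unfolding irreducible_factors_def[symmetric] using assms by auto
qed

lemma irreducible_factors_dvd_mono:
  fixes f g :: "'a::field poly"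
  assumes "lead_coeff f = 1" "lead_coeff g = 1" "f dvd g"
  shows "irreducible_factors f \<subseteq># irreducible_factors g"
proof -
  obtain h where h: "g = f * h" using assms(3) by blast
  then have "lead_coeff h = 1" using assms(1,2) by (simp add: lead_coeff_mult)
  then have "irreducible_factors g = irreducible_factors f + irreducible_factors h"
    using irreducible_factors_spec[OF assms(1)] irreducible_factors_spec[OF assms(2)]
      irreducible_factors_spec[of h] h
    by (intro monic_irreducible_multiset_unique) auto
  then show ?thesis by simp
qed

lemma degree_prod_mset:
  fixes A :: "'a::field poly multiset"
  assumes "0 \<notin># A"
  shows "degree (prod_mset A) = (\<Sum>f\<in>#A. degree f)"
  using assms by (induction A) (auto simp: degree_mult_eq)

lemma not_power_Suc_count_dvd_prod_mset:
  fixes p :: "'a::field poly"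
  assumes "\<forall>f\<in>#A. lead_coeff f = 1 \<and> irreducible f" "lead_coeff p = 1" "irreducible p"
  shows "\<not> p ^ Suc (count A p) dvd prod_mset A"
proof
  let ?B = "filter_mset (\<lambda>f. f \<noteq> p) A"
  assume "p ^ Suc (count A p) dvd prod_mset A"
  moreover have "A = replicate_mset (count A p) p + ?B"
    by (simp add: multiset_eq_iff)
  then have "prod_mset A = p ^ count A p * prod_mset ?B"
    by (metis prod_mset.union prod_mset_replicate_mset)
  ultimately have "p ^ count A p * p dvd p ^ count A p * prod_mset ?B" by (simp add: mult.commute)
  moreover have "p \<noteq> 0" using assms(3) by auto
  ultimately have "p dvd prod_mset ?B" by simp
  moreover have "prime_elem p" using assms(3) by (rule field_poly_irreducible_imp_prime)
  ultimately obtain f where "f \<in># ?B" "p dvd f" using prime_elem_dvd_prod_msetE by blast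
  then show False using monic_irreducible_dvd_eq[of p f] assms by auto
qed

text \<open>
  Moving a factor \<open>p\<close> from \<open>A\<close> to \<open>B\<close> is an admissible exchange if \<open>p\<close> occurs more often in
  \<open>A\<close>: then the power of \<open>p\<close> in a common divisor is bounded by the smaller count, the one in
  \<open>B\<close>, so it still divides the product of \<open>A\<close> after one copy of \<open>p\<close> has been removed.
\<close>
lemma common_divisor_transfer:
  fixes p :: "'a::field poly"
  assumes A: "\<forall>f\<in>#A. lead_coeff f = 1 \<and> irreducible f"
    and B: "\<forall>f\<in>#B. lead_coeff f = 1 \<and> irreducible f"
    and count: "count B p < count A p" and c: "c dvd prod_mset A" "c dvd prod_mset B"
  shows "c dvd prod_mset (A - {#p#}) \<and> c dvd prod_mset (add_mset p B)"
proof
  have "p \<in># A" using count by (metis count_inI not_less_zero)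
  then have p: "lead_coeff p = 1" "irreducible p" using A by auto
  then have prime: "prime_elem p" "p \<noteq> 0" by (auto intro: field_poly_irreducible_imp_prime)
  obtain e where e: "prod_mset A = c * e" using c(1) by blast
  have split: "prod_mset A = p * prod_mset (A - {#p#})"
    using \<open>p \<in># A\<close> by (metis insert_DiffM prod_mset.add_mset)
  have "p dvd e"
  proof (rule ccontr)
    assume "\<not> p dvd e"
    have "replicate_mset (Suc (count B p)) p \<subseteq># A"
      using count by (simp add: subseteq_mset_def)
    then have "p ^ Suc (count B p) dvd prod_mset A"
      by (metis prod_mset_subset_imp_dvd prod_mset_replicate_mset)
    then have "p ^ Suc (count B p) dvd e * c" unfolding e by (simp only: mult.commute)
    then have "p ^ Suc (count B p) dvd c"
      using prime_power_dvd_multD[OF prime(1)] \<open>\<not> p dvd e\<close> by blast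
    then show False using c(2) not_power_Suc_count_dvd_prod_mset[OF B p] dvd_trans by blast
  qed
  then obtain e' where "e = p * e'" by blast
  then have "prod_mset (A - {#p#}) = c * e'"
    using e split prime(2) by (simp add: mult.left_commute)
  then show "c dvd prod_mset (A - {#p#})" by simp
  show "c dvd prod_mset (add_mset p B)" using c(2) by simp
qed

section \<open>Configurations that can be reached by transfers\<close>

text \<open>
  A configuration \<open>M\<close> can be turned into any \<open>N\<close> with the same union by moving copies of \<open>p\<close>
  from places with too many to places with too few, provided that \<open>N\<close> distributes each \<open>p\<close> that
  moves evenly, up to 1. Evenness makes every such move one from a larger count to a smaller one:
  \<open>count (M j) p < count (N j) p \<le> count (N i) p + 1 \<le> count (M i) p\<close>. The total excess of \<open>M\<close>
  over \<open>N\<close> decreases. The predicate \<open>A\<close> stands for reachability.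
\<close>
lemma balancing_transfers:
  fixes M N :: "nat \<Rightarrow> 'b multiset"
  assumes step: "\<And>M i j p. A M \<Longrightarrow> i < n \<Longrightarrow> j < n \<Longrightarrow> count (M j) p < count (M i) p \<Longrightarrow>
      A (M(i := M i - {#p#}, j := add_mset p (M j)))"
    and "A M" and "(\<Sum>i<n. M i) = (\<Sum>i<n. N i)"
    and "\<And>i j p. i < n \<Longrightarrow> j < n \<Longrightarrow> count (N i) p < count (M i) p \<Longrightarrow>
      count (M j) p < count (N j) p \<Longrightarrow> count (N j) p \<le> count (N i) p + 1"
  shows "\<exists>M'. A M' \<and> (\<forall>i<n. M' i = N i)"
  using assms(2-)
proof (induction "\<Sum>i<n. size (M i - N i)" arbitrary: M rule: less_induct)
  case less
  show ?case
  proof (cases "\<forall>i<n. M i \<subseteq># N i")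
    case True
    have "size (M i) = size (N i)" if "i < n" for i
    proof (rule sum_mono_inv[of "\<lambda>i. size (M i)" "{..<n}" "\<lambda>i. size (N i)"])
      show "(\<Sum>i<n. size (M i)) = (\<Sum>i<n. size (N i))"
        using less.prems(2) by (metis size_multiset_sum)
    qed (use True that in \<open>auto intro: size_mset_mono\<close>)
    then have "\<forall>i<n. M i = N i"
      using True by (metis mset_subset_size subset_mset.le_imp_less_or_eq less_irrefl)
    then show ?thesis using less.prems(1) by blast
  next
    case False
    then obtain i p where i: "i < n" and p: "count (N i) p < count (M i) p"
      by (auto simp: subseteq_mset_def not_le)
    have totals: "(\<Sum>j<n. count (M j) p) = (\<Sum>j<n. count (N j) p)"
      using less.prems(2) by (metis count_sum)
    obtain j where j: "j < n" "count (M j) p < count (N j) p"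
    proof (rule ccontr)
      assume "\<not> thesis"
      then have "\<forall>j<n. count (N j) p \<le> count (M j) p" using that not_less by blast
      then have "(\<Sum>j<n. count (N j) p) < (\<Sum>j<n. count (M j) p)"
        using i p by (intro sum_strict_mono_ex1) auto
      then show False using totals by simp
    qed
    have "i \<noteq> j" using p j by auto
    have gap: "count (M j) p < count (M i) p" using less.prems(3)[OF i j(1) p j(2)] p j(2) by simp
    let ?M = "M(i := M i - {#p#}, j := add_mset p (M j))"
    have "(\<Sum>l<n. ?M l) = (\<Sum>l<n. N l)"
    proof -
      have two: "(\<Sum>l<n. h l) = h i + (h j + (\<Sum>l\<in>{..<n} - {i} - {j}. h l))"
        for h :: "nat \<Rightarrow> 'b multiset"
        using i j(1) \<open>i \<noteq> j\<close> sum.remove[of "{..<n}" i h] sum.remove[of "{..<n} - {i}" j h] by simp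
      have "(\<Sum>l<n. ?M l) = ?M i + (?M j + (\<Sum>l\<in>{..<n} - {i} - {j}. ?M l))" by (rule two)
      also have "(\<Sum>l\<in>{..<n} - {i} - {j}. ?M l) = (\<Sum>l\<in>{..<n} - {i} - {j}. M l)"
        by (intro sum.cong) auto
      also have "?M i + (?M j + \<dots>) = M i + (M j + \<dots>)"
        using gap \<open>i \<noteq> j\<close> by (simp add: multiset_eq_iff)
      also have "\<dots> = (\<Sum>l<n. M l)" by (rule two[symmetric])
      also have "\<dots> = (\<Sum>l<n. N l)" by (rule less.prems(2))
      finally show ?thesis .
    qed
    moreover have "count (N j') p' \<le> count (N i') p' + 1" if "i' < n" "j' < n"
      "count (N i') p' < count (?M i') p'" "count (?M j') p' < count (N j') p'" for i' j' p'
    proof -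
      have "count (N i') p' < count (M i') p'" "count (M j') p' < count (N j') p'"
        using that(3,4) p j(2) \<open>i \<noteq> j\<close> by (simp_all split: if_splits)
      then show ?thesis using less.prems(3)[OF that(1,2)] by simp
    qed
    moreover have "(\<Sum>l<n. size (?M l - N l)) < (\<Sum>l<n. size (M l - N l))"
    proof (rule sum_strict_mono_ex1)
      have le: "?M l - N l \<subseteq># M l - N l" for l
        using j \<open>i \<noteq> j\<close> by (auto simp: subseteq_mset_def)
      then show "\<forall>l\<in>{..<n}. size (?M l - N l) \<le> size (M l - N l)"
        by (blast intro: size_mset_mono)
      have "count (?M i - N i) p < count (M i - N i) p" using p \<open>i \<noteq> j\<close> by simp
      then have "?M i - N i \<subset># M i - N i"
        using le[of i] unfolding subset_mset.less_le by (metis less_irrefl)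
      then show "\<exists>l\<in>{..<n}. size (?M l - N l) < size (M l - N l)"
        using i mset_subset_size by blast
    qed simp
    moreover have "A ?M" by (rule step[OF less.prems(1) i j(1) gap])
    ultimately show ?thesis by (intro less.hyps)
  qed
qed

text \<open>
  The analogue for sizes instead of multisets, by the argument behind Muirhead's theorem on
  majorization. If the sizes \<open>x\<close> differ from the target \<open>g\<close>, let \<open>j\<close> be the first place where they
  do, so \<open>x j < g j\<close>, and \<open>i\<close> the first place with \<open>g i < x i\<close>. Then \<open>j < i\<close>, and the prefix sums
  up to lengths in \<open>{j<..i}\<close> have a slack of at least 1, so that one element may move from \<open>i\<close> to
  \<open>j\<close>. As \<open>g\<close> is monotone, \<open>x j < g j \<le> g i < x i\<close>; hence some \<open>p\<close> occurs more often at \<open>i\<close> than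
  at \<open>j\<close>, and this is the one to be moved. Elements outside \<open>S\<close> stay where they are.
\<close>
lemma majorization_transfers:
  fixes M :: "nat \<Rightarrow> 'b multiset" and g :: "nat \<Rightarrow> nat"
  assumes step: "\<And>M i j p. A M \<Longrightarrow> i < n \<Longrightarrow> j < n \<Longrightarrow> count (M j) p < count (M i) p \<Longrightarrow>
      A (M(i := M i - {#p#}, j := add_mset p (M j)))"
    and mono: "\<And>i j. i \<le> j \<Longrightarrow> j < n \<Longrightarrow> g i \<le> g j"
    and "A M" and "(\<Sum>i<n. size (filter_mset S (M i))) = (\<Sum>i<n. g i)"
    and "\<And>m. m \<le> n \<Longrightarrow> (\<Sum>i<m. size (filter_mset S (M i))) \<le> (\<Sum>i<m. g i)"
  shows "\<exists>M'. A M' \<and> (\<forall>i<n. size (filter_mset S (M' i)) = g i \<and>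
      filter_mset (\<lambda>p. \<not> S p) (M' i) = filter_mset (\<lambda>p. \<not> S p) (M i))"
  using assms(3-)
proof (induction "\<Sum>i<n. size (filter_mset S (M i)) - g i" arbitrary: M rule: less_induct)
  case less
  let ?x = "\<lambda>M i. size (filter_mset S (M i))"
  show ?case
  proof (cases "\<forall>i<n. ?x M i = g i")
    case True
    then show ?thesis using less.prems(1) by blast
  next
    case False
    define j where "j = (LEAST j. j < n \<and> ?x M j \<noteq> g j)"
    have j: "j < n" "?x M j \<noteq> g j" using LeastI_ex[of "\<lambda>j. j < n \<and> ?x M j \<noteq> g j"] False
      unfolding j_def by auto
    have before_j: "?x M l = g l" if "l < j" for l
      using not_less_Least[OF that[unfolded j_def]] that j(1) by auto
    have "(\<Sum>l<Suc j. ?x M l) \<le> (\<Sum>l<Suc j. g l)" using j(1) by (intro less.prems(3)) simp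
    moreover have "(\<Sum>l<j. ?x M l) = (\<Sum>l<j. g l)" using before_j by simp
    ultimately have xj: "?x M j < g j" using j(2) by simp
    have "\<exists>i<n. g i < ?x M i"
    proof (rule ccontr)
      assume "\<not> ?thesis"
      then have "\<forall>l\<in>{..<n}. ?x M l \<le> g l" by (meson lessThan_iff not_less)
      then have "(\<Sum>l<n. ?x M l) < (\<Sum>l<n. g l)"
        using xj j(1) by (intro sum_strict_mono_ex1) auto
      then show False using less.prems(2) by simp
    qed
    define i where "i = (LEAST i. i < n \<and> g i < ?x M i)"
    have i: "i < n" "g i < ?x M i"
      using LeastI_ex[of "\<lambda>i. i < n \<and> g i < ?x M i"] \<open>\<exists>i<n. g i < ?x M i\<close> unfolding i_def by auto
    have before_i: "?x M l \<le> g l" if "l < i" for l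
      using not_less_Least[OF that[unfolded i_def]] that i(1) by auto
    have "j < i" using i(2) xj before_j by (metis less_irrefl less_asym nat_neq_iff)
    then have "?x M j < ?x M i" using mono[of j i] i xj by simp
    then have "\<not> filter_mset S (M i) \<subseteq># filter_mset S (M j)" using size_mset_mono not_less by blast
    then obtain p where "count (filter_mset S (M j)) p < count (filter_mset S (M i)) p"
      by (auto simp: subseteq_mset_def not_le)
    then have p: "S p" "count (M j) p < count (M i) p" by (auto split: if_splits)
    let ?M = "M(i := M i - {#p#}, j := add_mset p (M j))"
    have "p \<in># M i" using p(2) by (metis count_inI not_less_zero)
    then have "p \<in># filter_mset S (M i)" using p(1) by simp
    then have "size (filter_mset S (M i - {#p#})) = ?x M i - 1"
      using p(1) by (simp add: filter_diff_mset size_Diff_singleton)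
    then have xM: "?x ?M l = (if l = i then ?x M i - 1 else if l = j then ?x M j + 1 else ?x M l)" for l
      using p(1) \<open>j < i\<close> by simp
    have prefix: "(\<Sum>l<m. ?x ?M l) = (\<Sum>l<m. ?x M l) + (if j < m \<and> m \<le> i then 1 else 0)" for m
    proof (induction m)
      case (Suc m)
      show ?case
        unfolding sum.lessThan_Suc Suc.IH unfolding xM using \<open>j < i\<close> i(2) by auto
    qed simp
    have "(\<Sum>l<n. ?x ?M l) = (\<Sum>l<n. g l)" using prefix[of n] i(1) less.prems(2) by simp
    moreover have "(\<Sum>l<m. ?x ?M l) \<le> (\<Sum>l<m. g l)" if "m \<le> n" for m
    proof (cases "j < m \<and> m \<le> i")
      case True
      then have "(\<Sum>l<m. ?x M l) < (\<Sum>l<m. g l)"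
        using before_i xj by (intro sum_strict_mono_ex1) auto
      then show ?thesis unfolding prefix using True by simp
    next
      case False
      then show ?thesis unfolding prefix if_not_P[OF False] using less.prems(3)[OF that] by simp
    qed
    moreover have "(\<Sum>l<n. ?x ?M l - g l) < (\<Sum>l<n. ?x M l - g l)"
    proof (rule sum_strict_mono_ex1)
      show "\<forall>l\<in>{..<n}. ?x ?M l - g l \<le> ?x M l - g l" unfolding xM using xj i(2) \<open>j < i\<close> by auto
      have "?x ?M i - g i < ?x M i - g i" unfolding xM using i(2) by simp
      then show "\<exists>l\<in>{..<n}. ?x ?M l - g l < ?x M l - g l" using i(1) by blast
    qed simp
    moreover have "A ?M" by (rule step[OF less.prems(1) i(1) j(1) p(2)])
    ultimately have "\<exists>M'. A M' \<and> (\<forall>l<n. ?x M' l = g l \<and>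
        filter_mset (\<lambda>p. \<not> S p) (M' l) = filter_mset (\<lambda>p. \<not> S p) (?M l))"
      by (intro less.hyps)
    moreover have "filter_mset (\<lambda>p. \<not> S p) (?M l) = filter_mset (\<lambda>p. \<not> S p) (M l)" for l
      using p(1) by (simp add: filter_diff_mset)
    ultimately show ?thesis by simp
  qed
qed

text \<open>
  Majorization is defined by the largest entries. For vectors that are already non-decreasing
  these are the suffixes, and since the totals agree, the inequalities for the suffixes become
  opposite ones for the prefixes.
\<close>
lemma majorizes_prefix_sums:
  assumes maj: "majorizes (map x [0..<n]) (map g [0..<n])"
    and x: "\<And>i j. i \<le> j \<Longrightarrow> j < n \<Longrightarrow> x i \<le> x j"
    and g: "\<And>i j. i \<le> j \<Longrightarrow> j < n \<Longrightarrow> g i \<le> g j"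
  shows "(\<Sum>i<n. x i) = (\<Sum>i<n. g i)" and "m \<le> n \<Longrightarrow> (\<Sum>i<m. x i) \<le> (\<Sum>i<m. g i)"
proof -
  have "sort (map x [0..<n]) = map x [0..<n]" "sort (map g [0..<n]) = map g [0..<n]"
    using x g by (auto intro!: sort_key_id_if_sorted simp: sorted_iff_nth_mono)
  then have tails: "sum_list (take l (rev (map g [0..<n]))) \<le> sum_list (take l (rev (map x [0..<n])))"
    if "l \<in> {1..n}" for l using maj that unfolding majorizes_def by simp
  have lists: "sum_list (map h [0..<m]) = (\<Sum>i<m. h i)" for h :: "nat \<Rightarrow> int" and m
    by (simp add: interv_sum_list_conv_sum_set_nat atLeast0LessThan)
  show eq: "(\<Sum>i<n. x i) = (\<Sum>i<n. g i)"
    using maj unfolding majorizes_def lists by simp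
  show "(\<Sum>i<m. x i) \<le> (\<Sum>i<m. g i)" if "m \<le> n"
  proof (cases "m = n")
    case True
    then show ?thesis using eq by simp
  next
    case False
    have split: "sum_list (take (n - m) (rev (map h [0..<n]))) = (\<Sum>i<n. h i) - (\<Sum>i<m. h i)"
      for h :: "nat \<Rightarrow> int"
    proof -
      have "take (n - m) (rev (map h [0..<n])) = rev (map h [m..<n])"
        using that by (simp add: take_rev drop_map)
      then have "sum_list (take (n - m) (rev (map h [0..<n]))) = (\<Sum>i = m..<n. h i)"
        by (simp add: sum_list_rev interv_sum_list_conv_sum_set_nat)
      then show ?thesis using sum.atLeastLessThan_concat[of 0 m n h] that by (simp add: atLeast0LessThan)
    qed
    show ?thesis using tails[of "n - m"] False that eq unfolding split by simp
  qed
qed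

section \<open>Stacking\<close>

text \<open>
  A stacking may list elements of equal degree in any order, and equal elements need not be
  neighbours. Reordering within each degree does not change the degrees of the stacked products, so
  equal elements can be grouped together: sort by a key that refines the degree order and is
  injective.
\<close>
lemma rearrange_by_injective_key:
  fixes a :: "'b list" and d :: "'b \<Rightarrow> nat"
  assumes "sorted_wrt (\<ge>) (map d a)"
  shows "\<exists>b f. mset b = mset a \<and> map d b = map d a \<and> sorted (map f b) \<and> inj_on (f :: 'b \<Rightarrow> nat) (set b)"
proof -
  obtain e :: "'b \<Rightarrow> nat" where e: "inj_on e (set a)"
    using finite_imp_inj_to_nat_seg[OF finite_set[of a]] by blast
  define K where "K = Suc (Max (insert 0 (e ` set a)))"
  define D where "D = Max (insert 0 (d ` set a))"
  have K: "e x < K" if "x \<in> set a" for x unfolding K_def using that by (simp add: le_imp_less_Suc)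
  have D: "d x \<le> D" if "x \<in> set a" for x unfolding D_def using that by simp
  \<comment> \<open>The lexicographic order by decreasing degree \<open>d\<close> and then \<open>e\<close>, in base \<open>K\<close>.\<close>
  define f where "f x = (D - d x) * K + e x" for x
  have divmod: "f x div K = D - d x" "f x mod K = e x" if "x \<in> set a" for x
    unfolding f_def using K[OF that] by simp_all
  define b where "b = sort_key f a"
  have set: "set b = set a" unfolding b_def by simp
  have "inj_on f (set b)" unfolding set using e divmod(2) by (metis inj_on_def)
  moreover have sorted: "sorted (map f b)" unfolding b_def by simp
  moreover have "map d b = map d a"
  proof -
    have "sorted_wrt (\<lambda>x y. f x \<le> f y) b" using sorted by (simp add: sorted_map)
    then have "sorted_wrt (\<lambda>x y. d y \<le> d x) b"
    proof (rule sorted_wrt_mono_rel[rotated])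
      fix x y assume "x \<in> set b" "y \<in> set b" "f x \<le> f y"
      then have "D - d x \<le> D - d y" using divmod(1) set div_le_mono by metis
      then show "d y \<le> d x" using D[of x] D[of y] \<open>x \<in> set b\<close> \<open>y \<in> set b\<close> set by auto
    qed
    then have "sorted (rev (map d b))" "sorted (rev (map d a))"
      using assms by (simp_all add: sorted_wrt_rev sorted_wrt_map rev_map)
    moreover have "mset (rev (map d b)) = mset (rev (map d a))" unfolding b_def by simp
    ultimately show ?thesis by (metis properties_for_sort rev_rev_ident)
  qed
  moreover have "mset b = mset a" unfolding b_def by simp
  ultimately show ?thesis by blast
qed

text \<open>
  In a list that is sorted by an injective key, the copies of \<open>p\<close> occupy a block of consecutive
  indices, and such a block meets any two residue classes modulo \<open>n\<close> almost equally often. For the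
  proof, between two consecutive occurrences in column \<open>i\<close> there is one in column \<open>j\<close>; the map
  \<open>h\<close> below finds it.
\<close>
lemma key_sorted_stacking_balanced:
  fixes b :: "'b list" and f :: "'b \<Rightarrow> nat"
  assumes sorted: "sorted (map f b)" and inj: "inj_on f (set b)"
    and len: "length b = q * n" and ij: "i < n" "j < n"
  shows "count (mset (map (\<lambda>m. b ! (m * n + i)) [0..<q])) p
    \<le> count (mset (map (\<lambda>m. b ! (m * n + j)) [0..<q])) p + 1"
proof -
  define J where "J i = {m. m < q \<and> b ! (m * n + i) = p}" for i
  have fin: "finite (J i)" for i unfolding J_def by simp
  have count: "count (mset (map (\<lambda>m. b ! (m * n + i)) [0..<q])) p = card (J i)" for i
  proof -
    have "count (mset (map (\<lambda>m. b ! (m * n + i)) [0..<q])) p =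
        length (filter (\<lambda>m. b ! (m * n + i) = p) [0..<q])"
      by (induction q) auto
    also have "\<dots> = card (J i)"
      unfolding J_def by (simp add: distinct_length_filter Int_def conj_commute)
    finally show ?thesis .
  qed
  have bound: "m * n + l < length b" if "m < q" "l < n" for m l
  proof -
    have "m * n + l < Suc m * n" using that by simp
    also have "\<dots> \<le> q * n" using that by (intro mult_le_mono1) simp
    finally show ?thesis using len by simp
  qed
  have block: "b ! v = p" if "u \<le> v" "v \<le> w" "w < length b" "b ! u = p" "b ! w = p" for u v w
  proof -
    have "f (b ! u) \<le> f (b ! v)" "f (b ! v) \<le> f (b ! w)"
      using sorted_nth_mono[OF sorted, of u v] sorted_nth_mono[OF sorted, of v w] that by simp_all
    then have "f (b ! v) = f p" using that by simp
    then show ?thesis using inj that by (metis inj_onD le_less_trans nth_mem)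
  qed
  show ?thesis
  proof (cases "J i = {}")
    case True
    then show ?thesis unfolding count by simp
  next
    case False
    let ?top = "Max (J i)"
    define h where "h m = (if i \<le> j then m else Suc m)" for m
    have top: "?top \<in> J i" using False fin by simp
    have "h m \<in> J j" if "m \<in> J i - {?top}" for m
    proof -
      have m: "m \<in> J i" "m < ?top" using that fin by (auto simp: less_le)
      then have "Suc m * n \<le> ?top * n" by (intro mult_le_mono1) simp
      then have "m * n + i \<le> h m * n + j" "h m * n + j \<le> ?top * n + i"
        using ij unfolding h_def by auto
      moreover have "h m < q" using m top unfolding h_def J_def by auto
      ultimately show ?thesis
        using block[of "m * n + i" "h m * n + j" "?top * n + i"] bound[of ?top i] m(1) top ij(1)
        unfolding J_def by auto
    qed
    then have "card (J i - {?top}) \<le> card (J j)"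
      using fin by (intro card_inj_on_le[of h] image_subsetI) (auto simp: h_def inj_on_def)
    then show ?thesis unfolding count using top fin by simp
  qed
qed

lemma sum_mset_columns:
  fixes b :: "'b list"
  assumes "length b = q * n"
  shows "(\<Sum>i<n. mset (map (\<lambda>m. b ! (m * n + i)) [0..<q])) = mset b"
proof -
  have map_sum: "mset (map f [0..<q]) = (\<Sum>m<q. {#f m#})" for f :: "nat \<Rightarrow> 'b" and q
    by (induction q) auto
  have "(\<Sum>i<n. mset (map (\<lambda>m. b ! (m * n + i)) [0..<q])) = (\<Sum>m<q. \<Sum>i<n. {#b ! (m * n + i)#})"
    unfolding map_sum by (rule sum.swap)
  also have "\<dots> = (\<Sum>m<q. \<Sum>l = m * n..<m * n + n. {#b ! l#})"
    by (simp add: sum.shift_bounds_nat_ivl[of _ 0, simplified] atLeast0LessThan add.commute)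
  also have "\<dots> = (\<Sum>l<q * n. {#b ! l#})" by (rule sum.nat_group)
  also have "\<dots> = mset b" using map_sum[of "\<lambda>l. b ! l" "q * n"] assms by (metis map_nth)
  finally show ?thesis .
qed

text \<open>
  The columns \<open>N i\<close> come from the regrouped list and not from the given one, so their products
  need not be the entries of \<open>q\<close>; only the degrees agree. This is necessary: with irreducible
  quadratic \<open>p\<close> and \<open>r\<close>, the factors of \<open>diag(p, p * r\<^sup>2)\<close> may be listed as \<open>p, r, p, r\<close>, which stacks
  to \<open>p\<^sup>2\<close> and \<open>r\<^sup>2\<close>; but \<open>p\<close> divides all entries of every matrix with this Smith form.
\<close>
lemma stacking_columns:
  fixes H :: "'a::field poly multiset"
  assumes n: "0 < n" and stack: "stacking n H q"
    and H: "\<forall>f\<in>#H. lead_coeff f = 1 \<and> irreducible f"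
  shows "\<exists>N. (\<Sum>i<n. N i) = H \<and> (\<forall>i<n. (\<Sum>f\<in>#N i. degree f) = degree (q ! i)) \<and>
      (\<forall>i<n. \<forall>j<n. \<forall>p. count (N j) p \<le> count (N i) p + 1)"
    and "\<And>i j. i \<le> j \<Longrightarrow> j < n \<Longrightarrow> degree (q ! j) \<le> degree (q ! i)"
proof -
  define r where "r = (LEAST r. n dvd size H + r)"
  obtain a where a: "mset a = H + replicate_mset r 1" "sorted_wrt (\<ge>) (map degree a)"
    "q = map (\<lambda>i. \<Prod>j<length a div n. a ! (j * n + i)) [0..<n]"
    using stack unfolding stacking_def r_def by blast
  \<comment> \<open>Padding up to \<open>n * size H\<close> elements shows that the least padding exists.\<close>
  have "size H + size H * (n - 1) = n * size H" using n by (cases n) auto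
  then have "n dvd size H + size H * (n - 1)" by simp
  then have "n dvd size H + r" unfolding r_def by (rule LeastI)
  then have "n dvd length a" using a(1) by (metis size_mset size_replicate_mset size_union)
  then obtain l where l: "length a = l * n" by (metis dvd_def mult.commute)
  have div: "length a div n = l" using l n by simp
  have bound: "m * n + i < length a" if "m < l" "i < n" for m i
  proof -
    have "m * n + i < Suc m * n" using that by simp
    also have "\<dots> \<le> l * n" using that by (intro mult_le_mono1) simp
    finally show ?thesis using l by simp
  qed
  have nonzero: "f \<noteq> 0" if "f \<in> set a" for f
  proof -
    have "f \<in># H + replicate_mset r 1" using that a(1) by (metis set_mset_mset)
    then show ?thesis using H by (auto split: if_splits)
  qed
  have deg_q: "degree (q ! i) = (\<Sum>m<l. degree (a ! (m * n + i)))" if "i < n" for i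
    using that nonzero bound unfolding a(3) div by (simp add: degree_prod_eq_sum_degree)
  show "degree (q ! j) \<le> degree (q ! i)" if "i \<le> j" "j < n" for i j
  proof -
    have "degree (a ! (m * n + j)) \<le> degree (a ! (m * n + i))" if "m < l" for m
    proof (cases "i = j")
      case False
      then show ?thesis
        using sorted_wrt_nth_less[OF a(2), of "m * n + i" "m * n + j"] bound[OF that, of j] \<open>i \<le> j\<close> \<open>j < n\<close>
        by simp
    qed simp
    then show ?thesis using that by (auto simp: deg_q intro!: sum_mono)
  qed
  obtain b f where b: "mset b = mset a" "map degree b = map degree a" "sorted (map f b)"
    and f: "inj_on (f :: 'a poly \<Rightarrow> nat) (set b)"
    using rearrange_by_injective_key[OF a(2)] by blast
  have len: "length b = l * n" using b(2) l by (metis length_map)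
  define C where "C i = mset (map (\<lambda>m. b ! (m * n + i)) [0..<l])" for i
  \<comment> \<open>Dropping the padding again leaves the degrees of the products unchanged.\<close>
  define N where "N i = filter_mset (\<lambda>f. f \<noteq> 1) (C i)" for i
  have "1 \<notin># H" using H by auto
  then have "filter_mset (\<lambda>f. f \<noteq> 1) (mset a) = H"
    unfolding a(1) by (auto simp: multiset_eq_iff count_eq_zero_iff)
  moreover have "(\<Sum>i<n. C i) = mset a" unfolding C_def b(1)[symmetric] by (rule sum_mset_columns[OF len])
  moreover have "(\<Sum>i<m. N i) = filter_mset (\<lambda>f. f \<noteq> 1) (\<Sum>i<m. C i)" for m
    unfolding N_def by (induction m) auto
  ultimately have "(\<Sum>i<n. N i) = H" by simp
  moreover have "(\<Sum>f\<in>#N i. degree f) = degree (q ! i)" if "i < n" for i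
  proof -
    have "(\<Sum>f\<in>#filter_mset (\<lambda>f. f \<noteq> 1) X. degree f) = (\<Sum>f\<in>#X. degree f)" for X :: "'a poly multiset"
      by (induction X) auto
    then have "(\<Sum>f\<in>#N i. degree f) = (\<Sum>f\<in>#C i. degree f)" unfolding N_def .
    also have "\<dots> = sum_list (map (\<lambda>m. degree (b ! (m * n + i))) [0..<l])"
      unfolding C_def by (simp flip: mset_map add: sum_mset_sum_list o_def)
    also have "\<dots> = (\<Sum>m<l. degree (b ! (m * n + i)))"
      by (simp add: interv_sum_list_conv_sum_set_nat atLeast0LessThan)
    also have "\<dots> = (\<Sum>m<l. degree (a ! (m * n + i)))"
      using b(2) bound that len l by (intro sum.cong refl) (metis lessThan_iff nth_map)
    finally show ?thesis using deg_q[OF that] by simp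
  qed
  moreover have "count (N j) p \<le> count (N i) p + 1" if "i < n" "j < n" for i j p
    using key_sorted_stacking_balanced[OF b(3) f len that(2,1), of p] unfolding N_def C_def by auto
  ultimately show "\<exists>N. (\<Sum>i<n. N i) = H \<and> (\<forall>i<n. (\<Sum>f\<in>#N i. degree f) = degree (q ! i)) \<and>
      (\<forall>i<n. \<forall>j<n. \<forall>p. count (N j) p \<le> count (N i) p + 1)"
    by blast
qed

section \<open>Triangularizations of the given degree\<close>

theorem proposition5p11:
  fixes P :: "'a::field poly mat" and s :: "nat \<Rightarrow> 'a poly" and q :: "'a poly list"
    and n d k :: nat
  assumes "0 < n"
    and "P \<in> carrier_mat n n"
    and "matpoly_degree P = d"
    and "strictly_regular P"
    and "is_smith_form n s P"
    and "\<forall>f\<in>irreducible_divisors P. degree f \<le> k"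
    and "stacking n (\<Sum>i<n. {#f \<in># irreducible_factors (s i). 2 \<le> degree f \<and> degree f \<le> k#}) q"
    and "majorizes
           (map (\<lambda>i. int (size {#f \<in># irreducible_factors (s i). degree f = 1#})) [0..<n])
           (map (\<lambda>i. int d - int (degree (q ! i))) [0..<n])"
  shows "\<exists>T. triangularization P T \<and> matpoly_degree T = d"
proof -
  define F where "F i = irreducible_factors (s i)" for i
  define linear where "linear f \<longleftrightarrow> degree f = 1" for f :: "'a poly"
  define x where "x i = size (filter_mset linear (F i))" for i
  define H where "H i = filter_mset (\<lambda>f. \<not> linear f) (F i)" for i
  have monic: "lead_coeff (s i) = 1" if "i < n" for i
    using assms(5) that unfolding is_smith_form_def by blast
  have F: "\<forall>f\<in>#F i. lead_coeff f = 1 \<and> irreducible f" "prod_mset (F i) = s i" if "i < n" for i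
    using irreducible_factors_spec[OF monic[OF that]] unfolding F_def by auto
  have deg_le: "degree f \<le> k" if "f \<in># F i" "i < n" for f i
  proof -
    have "f dvd s i" "irreducible f" using F[OF that(2)] that(1) dvd_prod_mset by fastforce+
    then have "f \<in> irreducible_divisors P"
      using assms(5) that(2) unfolding irreducible_divisors_def by blast
    then show ?thesis using assms(6) by blast
  qed
  have "{#f \<in># irreducible_factors (s i). 2 \<le> degree f \<and> degree f \<le> k#} = H i" if "i < n" for i
  proof -
    have "degree f \<noteq> 0" if "f \<in># F i" for f
      using F(1)[OF \<open>i < n\<close>] that irreducible_not_unit is_unit_iff_degree
      by (metis not_irreducible_zero)
    then show ?thesis
      unfolding H_def linear_def F_def[symmetric]
      using deg_le[OF _ that] by (intro filter_mset_cong refl) fastforce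
  qed
  then have "stacking n (\<Sum>i<n. H i) q" using assms(7) by simp
  moreover have "\<forall>f\<in>#(\<Sum>i<n. H i). lead_coeff f = 1 \<and> irreducible f"
    using F(1) unfolding H_def by (auto simp: set_mset_sum)
  ultimately obtain N where N: "(\<Sum>i<n. N i) = (\<Sum>i<n. H i)"
    "\<forall>i<n. (\<Sum>f\<in>#N i. degree f) = degree (q ! i)"
    "\<forall>i<n. \<forall>j<n. \<forall>p. count (N j) p \<le> count (N i) p + 1"
    and q_mono: "\<And>i j. i \<le> j \<Longrightarrow> j < n \<Longrightarrow> degree (q ! j) \<le> degree (q ! i)"
    using stacking_columns[OF assms(1)] by metis

  have x_mono: "x i \<le> x j" if "i \<le> j" "j < n" for i j
    using that
  proof (induction j rule: dec_induct)
    case (step j)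
    then have "F j \<subseteq># F (Suc j)" unfolding F_def
      using assms(5) monic unfolding is_smith_form_def by (intro irreducible_factors_dvd_mono) auto
    then have "x j \<le> x (Suc j)" unfolding x_def by (intro size_mset_mono multiset_filter_mono)
    then show ?case using step by simp
  qed simp
  have maj: "majorizes (map (\<lambda>i. int (x i)) [0..<n]) (map (\<lambda>i. int d - int (degree (q ! i))) [0..<n])"
    using assms(8) unfolding x_def F_def linear_def by simp
  note sums = majorizes_prefix_sums[OF maj]
  \<comment> \<open>The prefix sums of length 1 bound the first gap, the smallest one, below by \<open>x 0\<close>.\<close>
  have "int (x 0) \<le> int d - int (degree (q ! 0))"
    using sums(2)[of 1] assms(1) x_mono q_mono by simp
  then have le_d: "degree (q ! i) \<le> d" if "i < n" for i
    using q_mono[of 0 i] that by simp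
  define g where "g i = d - degree (q ! i)" for i
  have g: "int d - int (degree (q ! i)) = int (g i)" if "i < n" for i
    unfolding g_def using le_d[OF that] by simp
  have g_mono: "g i \<le> g j" if "i \<le> j" "j < n" for i j
    unfolding g_def using q_mono[OF that] by (rule diff_le_mono2)
  have prefix: "(\<Sum>i<m. x i) \<le> (\<Sum>i<m. g i)" if "m \<le> n" for m
  proof -
    have "(\<Sum>i<m. int (x i)) \<le> (\<Sum>i<m. int d - int (degree (q ! i)))"
      using sums(2)[OF _ _ that] x_mono q_mono by simp
    also have "\<dots> = (\<Sum>i<m. int (g i))" using g that by (intro sum.cong) auto
    finally show ?thesis by (simp flip: of_nat_sum)
  qed
  have total: "(\<Sum>i<n. x i) = (\<Sum>i<n. g i)"
  proof -
    have "(\<Sum>i<n. int (x i)) = (\<Sum>i<n. int d - int (degree (q ! i)))"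
      using sums(1) x_mono q_mono by simp
    also have "\<dots> = (\<Sum>i<n. int (g i))" using g by (intro sum.cong) auto
    finally show ?thesis by (simp flip: of_nat_sum)
  qed

  \<comment> \<open>The distributions \<open>M\<close> of irreducible factors that occur on the diagonal of a triangular
    matrix equivalent to \<open>P\<close>.\<close>
  define A where "A M \<longleftrightarrow> (\<forall>i<n. \<forall>f\<in>#M i. lead_coeff f = 1 \<and> irreducible f) \<and>
    has_triangular_diagonal P n (\<lambda>i. prod_mset (M i))" for M
  have nonzero: "0 \<notin># M i" if "A M" "i < n" for M i
    using that unfolding A_def by auto
  have step: "A (M(i := M i - {#p#}, j := add_mset p (M j)))"
    if M: "A M" and ij: "i < n" "j < n" and count: "count (M j) p < count (M i) p" for M i j p
  proof -
    let ?M = "M(i := M i - {#p#}, j := add_mset p (M j))"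
    have "i \<noteq> j" using count by auto
    have p: "p \<in># M i" using count by (metis count_inI not_less_zero)
    have "has_triangular_diagonal P n ((\<lambda>l. prod_mset (M l))
      (i := prod_mset (M i - {#p#}), j := prod_mset (add_mset p (M j))))"
    proof (rule diagonal_exchange)
      show "has_triangular_diagonal P n (\<lambda>l. prod_mset (M l))" using M unfolding A_def by blast
      show "prod_mset (M l) \<noteq> 0" if "l < n" for l using nonzero[OF M that] by simp
      show "prod_mset (M i - {#p#}) * prod_mset (add_mset p (M j)) = prod_mset (M i) * prod_mset (M j)"
        using insert_DiffM[OF p] by (metis mult.assoc mult.commute prod_mset.add_mset)
      show "c dvd prod_mset (M i - {#p#}) \<and> c dvd prod_mset (add_mset p (M j))"
        if "c dvd prod_mset (M i)" "c dvd prod_mset (M j)" for c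
        using M ij count that unfolding A_def by (intro common_divisor_transfer) auto
    qed (use ij \<open>i \<noteq> j\<close> in auto)
    also have "(\<lambda>l. prod_mset (M l)) (i := prod_mset (M i - {#p#}), j := prod_mset (add_mset p (M j))) =
        (\<lambda>l. prod_mset (?M l))"
      by auto
    finally show ?thesis using M p ij(1) unfolding A_def by (auto dest: in_diffD)
  qed

  have "unimodularly_equivalent P (mat_diag n s)" using assms(5) unfolding is_smith_form_def by blast
  then have "has_triangular_diagonal P n (\<lambda>i. prod_mset (F i))"
    unfolding has_triangular_diagonal_def triangularization_def upper_triangular_def using F(2)
    by (intro bexI[of _ "mat_diag n s"]) (auto simp: mat_diag_def)
  then have "A F" unfolding A_def using F(1) by blast
  then obtain M where M: "A M" "\<forall>i<n. size (filter_mset linear (M i)) = g i \<and>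
      filter_mset (\<lambda>f. \<not> linear f) (M i) = H i"
    using majorization_transfers[of A n g F linear, OF step g_mono] prefix total
    unfolding x_def H_def by blast
  \<comment> \<open>Keep the linear factors that each entry has received and rearrange the others. Only
    nonlinear factors move, so evenness matters only for these.\<close>
  define K where "K i = N i + filter_mset linear (M i)" for i
  have "\<exists>M'. A M' \<and> (\<forall>i<n. M' i = K i)"
  proof (rule balancing_transfers[of A n M K, OF step])
    have "M i = H i + filter_mset linear (M i)" if "i < n" for i
      using M(2) that multiset_partition[of "M i" linear] by (simp add: union_commute)
    then have "(\<Sum>i<n. M i) = (\<Sum>i<n. H i + filter_mset linear (M i))" by (intro sum.cong) auto
    then show "(\<Sum>i<n. M i) = (\<Sum>i<n. K i)" unfolding K_def sum.distrib N(1) .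
    fix i j p assume ij: "i < n" "j < n" and "count (K i) p < count (M i) p"
    have "\<not> linear p"
    proof
      assume "linear p"
      then have "count (K i) p \<ge> count (M i) p" unfolding K_def by simp
      then show False using \<open>count (K i) p < count (M i) p\<close> by simp
    qed
    then show "count (K j) p \<le> count (K i) p + 1" unfolding K_def using N(3) ij by simp
  qed (use M(1) in auto)
  then obtain M' where M': "A M'" "\<forall>i<n. M' i = K i" by blast
  have "prod_mset (M' i) \<noteq> 0 \<and> degree (prod_mset (M' i)) = d" if "i < n" for i
  proof -
    have "(\<Sum>f\<in>#filter_mset linear X. degree f) = size (filter_mset linear X)" for X
      unfolding linear_def by (induction X) auto
    then have "(\<Sum>f\<in>#M' i. degree f) = degree (q ! i) + g i"
      using M' M(2) N(2) that unfolding K_def by simp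
    then show ?thesis
      using nonzero[OF M'(1) that] le_d[OF that] unfolding g_def by (simp add: degree_prod_mset)
  qed
  then show ?thesis
    using M'(1) assms(1) unfolding A_def
    by (intro triangularization_of_uniform_diagonal_degree[of P n "\<lambda>i. prod_mset (M' i)"]) auto
qed

end
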